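(* Let $W=\mathcal{S}_{n+1}$, let $\tilde{w}_0=s_{i_1}\cdots s_{i_N}$ be a reduced expression of its longest element, and for $1\le k\le N$ let $Z_k$ be the zone of the wiring diagram $\mathcal{WD}(\tilde{w}_0)$ whose leftmost point is the crossing $x_k$. (a) The label $J(Z_k)$ is $w_k\cdot(1,2,\ldots,i_k)$ (as a set of indices), where $w_k=s_{i_1}s_{i_2}\cdots s_{i_k}$. (b) Two chambers $Z_j$ on the $i$-th level and $Z_k$ on the $(i+1)$-th level are adjacent if and only if a pseudo-line $L_m$ passes between them, that is, if and only if $J(Z_k)=J(Z_j)\cup\{m\}$ for some $m\notin J(Z_j)$.
   Context: $W=\mathcal{S}_{n+1}$ with simple reflections $s_i=(i\ \,i+1)$, products composed as functions (right factor first), and $N=n(n+1)/2$. The wiring diagram $\mathcal{WD}(\tilde w_0)$ of a reduced expression $\tilde w_0=s_{i_1}\cdots s_{i_N}$ of the longest element is the arrangement of $n+1$ pseudo-lines $L_1,\dots,L_{n+1}$ in the plane $\mathbb{R}^2$, running from $x=-\infty$ to $x=+\infty$, defined as follows: at $x=-\infty$ the lines are numbered $1,\dots,n+1$ from top to bottom; there are crossing points $x_1,\dots,x_N$, with strictly increasing abscissas; at $x_k$ the two lines currently in positions $i_k$ and $i_k+1$ from the top are interchanged (one says that $x_k$ is on level $i_k$), and there are no other crossings. At $x=+\infty$ the order of the lines is reversed and each pair of lines crosses exactly once. The pseudo-lines partition the plane into zones (chambers). The label $J(Z)$ of a zone $Z$ is the set of indices of the pseudo-lines passing above it; distinct zones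 have distinct labels. For each $k$ there is a unique zone $Z_k$ bounded on the left by $x_k$, i.e. whose leftmost point is $x_k$; its level is the level $i_k$ of $x_k$. This zone lies, over each abscissa it meets, between the lines in positions $i_k$ and $i_k+1$. Two zones are adjacent if they are separated by a common boundary segment (of positive length) of a pseudo-line. *)

theory Defs
  imports "HOL-Analysis.Analysis" "HOL-Combinatorics.Permutations"
begin

section \<open>Reduced expressions in the symmetric group\<close>

text \<open>The group \<open>S\<^sub>n\<^sub>+\<^sub>1\<close> consists of the \<open>w :: nat \<Rightarrow> nat\<close> with \<open>w permutes {1..n + 1}\<close>.
  A word \<open>s\<^sub>i\<^sub>1 \<dots> s\<^sub>i\<^sub>N\<close> is given by its length and by the function \<open>k \<mapsto> i\<^sub>k\<close>, of which only the
  values on \<open>{1..N}\<close> matter.\<close>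

definition simple_reflection :: "nat \<Rightarrow> nat \<Rightarrow> nat" where
  "simple_reflection i = Transposition.transpose i (i + 1)"

primrec word_prod :: "(nat \<Rightarrow> nat) \<Rightarrow> nat \<Rightarrow> nat \<Rightarrow> nat" where
  "word_prod i 0 = id"
| "word_prod i (Suc k) = word_prod i k \<circ> simple_reflection (i (Suc k))"

definition is_expression :: "nat \<Rightarrow> nat \<Rightarrow> (nat \<Rightarrow> nat) \<Rightarrow> (nat \<Rightarrow> nat) \<Rightarrow> bool" where
  "is_expression n N i w \<longleftrightarrow> (\<forall>k\<in>{1..N}. i k \<in> {1..n}) \<and> word_prod i N = w"

definition coxeter_length :: "nat \<Rightarrow> (nat \<Rightarrow> nat) \<Rightarrow> nat" where
  "coxeter_length n w = (LEAST l. \<exists>i. is_expression n l i w)"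

definition reduced_expression :: "nat \<Rightarrow> nat \<Rightarrow> (nat \<Rightarrow> nat) \<Rightarrow> (nat \<Rightarrow> nat) \<Rightarrow> bool" where
  "reduced_expression n N i w \<longleftrightarrow> is_expression n N i w \<and> N = coxeter_length n w"

definition longest_element :: "nat \<Rightarrow> (nat \<Rightarrow> nat) \<Rightarrow> bool" where
  "longest_element n w \<longleftrightarrow> w permutes {1..n + 1} \<and>
     (\<forall>v. v permutes {1..n + 1} \<longrightarrow> coxeter_length n v \<le> coxeter_length n w)"

section \<open>Wiring diagrams\<close>

text \<open>The pseudo-line \<open>L\<^sub>m\<close> runs monotonically from \<open>x = -\<infinity>\<close> to \<open>x = +\<infinity>\<close>, so it is given as the
  graph of a continuous function \<open>L m\<close>. Positions are counted from the top, starting at 1.\<close>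

definition pseudo_line :: "(nat \<Rightarrow> real \<Rightarrow> real) \<Rightarrow> nat \<Rightarrow> (real \<times> real) set" where
  "pseudo_line L m = {(t, L m t) | t. True}"

definition line_position :: "nat \<Rightarrow> (nat \<Rightarrow> real \<Rightarrow> real) \<Rightarrow> real \<Rightarrow> nat \<Rightarrow> nat" where
  "line_position n L t m = card {r \<in> {1..n + 1}. L r t > L m t} + 1"

text \<open>\<open>crosses_at n L c l\<close>: at the point \<open>c\<close>, the two lines in positions \<open>l\<close> and \<open>l + 1\<close> are
  interchanged, and no other pair of lines meets over the abscissa of \<open>c\<close>.\<close>

definition crosses_at ::
  "nat \<Rightarrow> (nat \<Rightarrow> real \<Rightarrow> real) \<Rightarrow> real \<times> real \<Rightarrow> nat \<Rightarrow> bool" where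
  "crosses_at n L c l \<longleftrightarrow>
     (\<exists>p\<in>{1..n + 1}. \<exists>q\<in>{1..n + 1}.
        c \<in> pseudo_line L p \<and> c \<in> pseudo_line L q \<and>
        (\<forall>\<^sub>F t in at_left (fst c). line_position n L t p = l \<and> line_position n L t q = l + 1) \<and>
        (\<forall>\<^sub>F t in at_right (fst c). line_position n L t p = l + 1 \<and> line_position n L t q = l) \<and>
        (\<forall>r\<in>{1..n + 1}. \<forall>s\<in>{1..n + 1}.
           r \<noteq> s \<and> L r (fst c) = L s (fst c) \<longrightarrow> {r, s} = {p, q}))"

text \<open>\<open>L\<close> and the crossing points \<open>x 1, \<dots>, x N\<close> form a wiring diagram of the word \<open>i\<close>. A wiring
  diagram is only determined up to deformation, so this is a predicate.\<close>

definition wiring_diagram ::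
  "nat \<Rightarrow> nat \<Rightarrow> (nat \<Rightarrow> nat) \<Rightarrow> (nat \<Rightarrow> real \<Rightarrow> real) \<Rightarrow> (nat \<Rightarrow> real \<times> real) \<Rightarrow> bool" where
  "wiring_diagram n N i L x \<longleftrightarrow>
     (\<forall>m\<in>{1..n + 1}. continuous_on UNIV (L m)) \<and>
     strict_mono_on {1..N} (\<lambda>k. fst (x k)) \<and>
     (\<forall>t. (\<forall>k\<in>{1..N}. t < fst (x k)) \<longrightarrow>
        (\<forall>p\<in>{1..n + 1}. \<forall>q\<in>{1..n + 1}. p < q \<longrightarrow> L p t > L q t)) \<and>
     (\<forall>k\<in>{1..N}. crosses_at n L (x k) (i k)) \<and>
     (\<forall>t. t \<notin> (\<lambda>k. fst (x k)) ` {1..N} \<longrightarrow> inj_on (\<lambda>m. L m t) {1..n + 1})"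

section \<open>Zones\<close>

definition zones :: "nat \<Rightarrow> (nat \<Rightarrow> real \<Rightarrow> real) \<Rightarrow> (real \<times> real) set set" where
  "zones n L = components (- (\<Union>m\<in>{1..n + 1}. pseudo_line L m))"

definition label :: "nat \<Rightarrow> (nat \<Rightarrow> real \<Rightarrow> real) \<Rightarrow> (real \<times> real) set \<Rightarrow> nat set" where
  "label n L Z = {m \<in> {1..n + 1}. \<forall>(t, y)\<in>Z. y < L m t}"

text \<open>Zones are open, so the leftmost point is taken in the closure.\<close>

definition leftmost_point :: "(real \<times> real) set \<Rightarrow> real \<times> real \<Rightarrow> bool" where
  "leftmost_point Z c \<longleftrightarrow> c \<in> closure Z \<and> (\<forall>p\<in>closure Z. p \<noteq> c \<longrightarrow> fst c < fst p)"

definition zone_from :: "nat \<Rightarrow> (nat \<Rightarrow> real \<Rightarrow> real) \<Rightarrow> real \<times> real \<Rightarrow> (real \<times> real) set" where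
  "zone_from n L c = (THE Z. Z \<in> zones n L \<and> leftmost_point Z c)"

definition adjacent ::
  "nat \<Rightarrow> (nat \<Rightarrow> real \<Rightarrow> real) \<Rightarrow> (real \<times> real) set \<Rightarrow> (real \<times> real) set \<Rightarrow> bool" where
  "adjacent n L A B \<longleftrightarrow> A \<noteq> B \<and>
     (\<exists>m\<in>{1..n + 1}. \<exists>a b. a < b \<and> (\<lambda>t. (t, L m t)) ` {a..b} \<subseteq> frontier A \<inter> frontier B)"

text \<open>\<open>L\<^sub>m\<close> passes between \<open>A\<close> and \<open>B\<close>: over some interval of abscissas, \<open>A\<close> lies immediately
  above \<open>L\<^sub>m\<close> and \<open>B\<close> immediately below it.\<close>

definition passes_between ::
  "(nat \<Rightarrow> real \<Rightarrow> real) \<Rightarrow> nat \<Rightarrow> (real \<times> real) set \<Rightarrow> (real \<times> real) set \<Rightarrow> bool" where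
  "passes_between L m A B \<longleftrightarrow>
     (\<exists>a b. a < b \<and> (\<forall>t\<in>{a<..<b}.
        (\<forall>\<^sub>F y in at_right (L m t). (t, y) \<in> A) \<and> (\<forall>\<^sub>F y in at_left (L m t). (t, y) \<in> B)))"

end

(* Call the set of lines above a point its label. The zones are exactly the nonempty sets of points
   with a given label off the lines. Indeed, deleting two equal reflections from a word does not
   change its product, so in the diagram of a reduced word two lines cross at most once and the
   abscissas where one is above the other form an interval. Hence the points with label S lie over
   an interval, with connected vertical sections, and form a connected open set.
   Between the crossings k and k + 1 the line in position a is w_k(a), which identifies the zone
   starting at x_k as the one labelled by w_k{1..i_k}. If S and S + {m} are labels of zones, the
   abscissas of these two zones overlap by connectedness, and there L_m separates them. *)

theory Submission imports Defs begin

abbreviation swap :: "nat \<Rightarrow> nat \<Rightarrow> nat \<Rightarrow> nat" where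
  "swap \<equiv> Transposition.transpose"

section \<open>Reduced words\<close>

lemma inj_comp_transpose:
  fixes f :: "nat \<Rightarrow> nat"
  assumes "inj f"
  shows "f \<circ> swap a b = swap (f a) (f b) \<circ> f"
  using assms by (auto simp: fun_eq_iff Transposition.transpose_def inj_eq)

lemma inj_word_prod: "inj (word_prod i k)"
  by (induction k) (simp_all add: simple_reflection_def inj_compose del: o_apply)

text \<open>Conjugation turns the exchange of two positions, on the right, into the exchange of the
  two lines that \<open>word_prod i k\<close> puts there, on the left. In this form the reflections
  of different letters can be compared.\<close>

lemma word_prod_Suc_transpose:
  "word_prod i (Suc k) =
     swap (word_prod i k (i (Suc k))) (word_prod i k (i (Suc k) + 1)) \<circ> word_prod i k"
  using inj_comp_transpose[OF inj_word_prod] by (simp add: simple_reflection_def)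

lemma word_prod_permutes:
  assumes "\<forall>k\<in>{1..N}. i k \<in> {1..n}" "k \<le> N"
  shows "word_prod i k permutes {1..n + 1}"
  using assms(2)
proof (induction k)
  case 0
  then show ?case by (simp add: permutes_def)
next
  case (Suc k)
  then have "i (Suc k) \<in> {1..n}" using assms(1) by auto
  then have "simple_reflection (i (Suc k)) permutes {1..n + 1}"
    unfolding simple_reflection_def by (intro permutes_swap_id) auto
  with Suc show ?case by (simp add: permutes_compose del: o_apply)
qed

text \<open>If the same reflection occurs for two letters of the word, deleting both leaves the product
  unchanged.\<close>

lemma reduced_expression_reflections_distinct:
  assumes red: "reduced_expression n N i w" and jk: "j < k" "k < N"
  shows "{word_prod i j (i (Suc j)), word_prod i j (i (Suc j) + 1)} \<noteq>
    {word_prod i k (i (Suc k)), word_prod i k (i (Suc k) + 1)}"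
proof
  \<comment> \<open>The reflection in the two lines exchanged by letter \<open>Suc j\<close>; by
    assumption letter \<open>Suc k\<close> gives the same one.\<close>
  define t where "t = swap (word_prod i j (i (Suc j))) (word_prod i j (i (Suc j) + 1))"
  assume "{word_prod i j (i (Suc j)), word_prod i j (i (Suc j) + 1)} =
    {word_prod i k (i (Suc k)), word_prod i k (i (Suc k) + 1)}"
  then have t': "t = swap (word_prod i k (i (Suc k))) (word_prod i k (i (Suc k) + 1))"
    by (auto simp: t_def doubleton_eq_iff transpose_commute)
  have tt: "t \<circ> (t \<circ> f) = f" for f :: "nat \<Rightarrow> nat"
    by (simp add: t_def fun_eq_iff)
  \<comment> \<open>The word with the letters at \<open>Suc j\<close> and \<open>Suc k\<close>
    deleted: indices shift by one after the first deletion and by two after the second.\<close>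
  define i' where "i' m = (if m \<le> j then i m else if m < k then i (Suc m) else i (m + 2))" for m
  have 1: "word_prod i' m = word_prod i m" if "m \<le> j" for m
    using that by (induction m) (auto simp: i'_def)
  \<comment> \<open>Between the deletions the missing letter costs one factor \<open>t\<close> on
    the left.\<close>
  have 2: "word_prod i' m = t \<circ> word_prod i (Suc m)" if "j \<le> m" "m < k" for m
    using that
  proof (induction m rule: dec_induct)
    case base
    show ?case unfolding word_prod_Suc_transpose t_def[symmetric] tt by (simp add: 1)
  next
    case (step m)
    then have "i' (Suc m) = i (Suc (Suc m))" by (simp add: i'_def)
    then show ?case using step by (simp add: o_assoc)
  qed
  \<comment> \<open>The second deletion absorbs this factor, since \<open>t\<close> also carries
    \<open>word_prod i k\<close> to \<open>word_prod i (Suc k)\<close>.\<close>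
  have 3: "word_prod i' m = word_prod i (m + 2)" if "k - 1 \<le> m" for m
    using that
  proof (induction m rule: dec_induct)
    case base
    have "word_prod i' (k - 1) = t \<circ> word_prod i k" using 2[of "k - 1"] jk by simp
    also have "\<dots> = word_prod i (Suc k)" unfolding word_prod_Suc_transpose t' ..
    finally show ?case using jk by simp
  next
    case (step m)
    then have "\<not> Suc m \<le> j" "\<not> Suc m < k" using jk by auto
    then have "i' (Suc m) = i (Suc (Suc (Suc m)))" by (simp add: i'_def)
    then show ?case using step by simp
  qed
  have "N - 2 + 2 = N" using jk by simp
  then have "word_prod i' (N - 2) = word_prod i N" using 3[of "N - 2"] jk by auto
  then have "is_expression n (N - 2) i' w"
    using red jk by (auto simp: reduced_expression_def is_expression_def i'_def)
  then have "coxeter_length n w \<le> N - 2"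
    unfolding coxeter_length_def by (intro Least_le) auto
  with red jk show False by (simp add: reduced_expression_def)
qed

section \<open>Continuous functions on the line\<close>

text \<open>Intermediate value theorem: a change of sign of \<open>g - f\<close> would force a zero
  on the connected set \<open>A\<close>.\<close>

lemma continuous_less_connected:
  fixes f g :: "real \<Rightarrow> real"
  assumes "connected A" "continuous_on A f" "continuous_on A g"
    and "\<And>t. t \<in> A \<Longrightarrow> f t \<noteq> g t"
    and "s \<in> A" "t \<in> A" "f s < g s"
  shows "f t < g t"
proof (rule ccontr)
  assume "\<not> f t < g t"
  have "connected ((\<lambda>t. g t - f t) ` A)"
    using assms by (intro connected_continuous_image continuous_intros)
  then have "0 \<in> (\<lambda>t. g t - f t) ` A"
    using assms(5-7) \<open>\<not> f t < g t\<close>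
      connected_contains_Icc[of _ "g t - f t" "g s - f s"] by fastforce
  then show False using assms(4) by force
qed

text \<open>On an open set \<open>fst\<close> is an open map onto its image, and an open map with
  connected fibres pulls connected sets back to connected sets.\<close>

lemma connected_if_connected_sections:
  fixes R :: "(real \<times> real) set"
  assumes "open R" "connected (fst ` R)" "\<And>t. connected {y. (t, y) \<in> R}"
  shows "connected R"
proof -
  have "connected (R \<inter> fst -` (fst ` R))"
  proof (rule connected_open_monotone_preimage[OF _ refl])
    show "continuous_on R fst" by (intro continuous_intros)
  next
    fix C assume "openin (top_of_set R) C"
    then have "open C" "C \<subseteq> R" using assms(1) by (simp_all add: openin_open_eq)
    then have "open (fst ` C)" by (simp add: open_image_fst)
    then show "openin (top_of_set (fst ` R)) (fst ` C)"
      using \<open>C \<subseteq> R\<close> by (intro open_subset image_mono)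
  next
    fix t :: real
    have "R \<inter> fst -` {t} = Pair t ` {y. (t, y) \<in> R}" by auto
    then show "connected (R \<inter> fst -` {t})"
      using assms(3)[of t] by (auto intro!: connected_continuous_image continuous_intros)
  qed (use assms in auto)
  moreover have "R \<inter> fst -` (fst ` R) = R" by auto
  ultimately show ?thesis by simp
qed

text \<open>The case of an empty set serves the regions above or below all lines.\<close>

lemma ex_real_between_finite_sets:
  fixes A B :: "real set"
  assumes "finite A" "finite B" "\<And>a b. a \<in> A \<Longrightarrow> b \<in> B \<Longrightarrow> a < b"
  shows "\<exists>y. (\<forall>a\<in>A. a < y) \<and> (\<forall>b\<in>B. y < b)"
proof (cases "A = {} \<or> B = {}")
  case True
  have "\<forall>b\<in>B. Min B - 1 < b"
    using Min_le[OF assms(2)] by (smt (verit))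
  moreover have "\<forall>a\<in>A. a < Max A + 1"
    using Max_ge[OF assms(1)] by (smt (verit))
  ultimately show ?thesis using True by blast
next
  case False
  then have "Max A < Min B" using assms by simp
  then obtain y where "Max A < y" "y < Min B" using dense by blast
  then show ?thesis using assms False by auto
qed

lemma transpose_Suc_less:
  fixes a b l :: nat
  assumes "a < b" "\<not> (a = l \<and> b = Suc l)"
  shows "swap l (Suc l) a < swap l (Suc l) b"
  using assms by (auto simp: Transposition.transpose_def)

section \<open>Order of the lines between two crossings\<close>

locale wiring =
  fixes n N :: nat and i w0 :: "nat \<Rightarrow> nat"
    and L :: "nat \<Rightarrow> real \<Rightarrow> real" and x :: "nat \<Rightarrow> real \<times> real"
  assumes reduced: "reduced_expression n N i w0"
    and diagram: "wiring_diagram n N i L x"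
begin

abbreviation "lines \<equiv> {1..n + 1}"

abbreviation "w \<equiv> word_prod i"

abbreviation "c k \<equiv> fst (x k)"

text \<open>The interval between two consecutive crossings. \<open>gap 0\<close> is unbounded to the
  left and \<open>gap N\<close> to the right; the bounded quantifiers cover these ends without a
  case distinction.\<close>

definition gap :: "nat \<Rightarrow> real set" where
  "gap k = {t. (\<forall>j\<in>{1..k}. c j < t) \<and> (\<forall>j\<in>{Suc k..N}. t < c j)}"

lemma letter: "k \<in> {1..N} \<Longrightarrow> i k \<in> {1..n}"
  using reduced by (auto simp: reduced_expression_def is_expression_def)

lemma w_permutes: "k \<le> N \<Longrightarrow> w k permutes lines"
  using letter by (intro word_prod_permutes) auto

lemma w_eq_iff: "w k a = w k b \<longleftrightarrow> a = b"
  using inj_word_prod by (auto simp: inj_eq)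

lemma w_mem: "k \<le> N \<Longrightarrow> a \<in> lines \<Longrightarrow> w k a \<in> lines"
  using permutes_in_image[OF w_permutes] by blast

lemma w_image: "k \<le> N \<Longrightarrow> w k ` lines = lines"
  using permutes_image[OF w_permutes] .

lemma w_obtain:
  assumes "k \<le> N" "m \<in> lines"
  obtains a where "a \<in> lines" "m = w k a"
  using w_image[OF assms(1)] assms(2) by blast

lemma cont: "m \<in> lines \<Longrightarrow> continuous_on A (L m)"
  using diagram by (meson continuous_on_subset subset_UNIV wiring_diagram_def)

lemma c_less: "1 \<le> j \<Longrightarrow> j < k \<Longrightarrow> k \<le> N \<Longrightarrow> c j < c k"
  using diagram by (auto simp: wiring_diagram_def strict_mono_on_def)

lemma connected_gap: "connected (gap k)"
proof -
  have "gap k = (\<Inter>j\<in>{1..k}. {c j<..}) \<inter> (\<Inter>j\<in>{Suc k..N}. {..<c j})"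
    by (auto simp: gap_def)
  then have "convex (gap k)"
    by (auto intro!: convex_Int convex_INT convex_real_interval)
  then show ?thesis by (rule convex_connected)
qed

text \<open>\<open>crosses_at\<close> describes the order only through the filters on both sides of
  a crossing; this and the next lemma carry it over to points of the adjoining gaps.\<close>

lemma eventually_gap_left:
  assumes "k < N"
  shows "\<forall>\<^sub>F t in at_left (c (Suc k)). t \<in> gap k"
proof -
  have "\<forall>\<^sub>F t in at_left (c (Suc k)). (\<forall>j\<in>{1..k}. c j < t) \<and> t < c (Suc k)"
    using assms
    by (intro eventually_conj eventually_ball_finite ballI order_tendstoD(1)[OF tendsto_ident_at])
      (auto intro: c_less simp: eventually_at_filter)
  then show ?thesis
  proof eventually_elim
    case (elim t)
    then show ?case
      using c_less[of "Suc k"] unfolding gap_def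
      by (fastforce simp: le_less Suc_le_eq)
  qed
qed

lemma eventually_gap_right:
  assumes "k < N"
  shows "\<forall>\<^sub>F t in at_right (c (Suc k)). t \<in> gap (Suc k)"
proof -
  have "\<forall>\<^sub>F t in at_right (c (Suc k)). (\<forall>j\<in>{Suc (Suc k)..N}. t < c j) \<and> c (Suc k) < t"
    using assms
    by (intro eventually_conj eventually_ball_finite ballI
        eventually_at_right_less order_tendstoD(2)[OF tendsto_ident_at]) (auto intro: c_less)
  then show ?thesis
  proof eventually_elim
    case (elim t)
    moreover have "c j < t" if "j \<in> {1..Suc k}" for j
      using c_less[of j "Suc k"] that elim assms by (cases "j = Suc k") auto
    ultimately show ?case unfolding gap_def by blast
  qed
qed

lemma gap_not_crossing: "t \<in> gap k \<Longrightarrow> t \<notin> c ` {1..N}"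
  by (fastforce simp: gap_def not_le[symmetric])

lemma between_gaps:
  assumes "k < N" "s \<in> gap k" "t \<in> gap (Suc k)" "u \<in> {s..t}" "u \<in> c ` {1..N}"
  shows "u = c (Suc k)"
proof -
  obtain j where j: "j \<in> {1..N}" "u = c j" using assms(5) by auto
  have "\<not> j \<le> k" using assms(2,4) j by (force simp: gap_def)
  moreover have "\<not> Suc (Suc k) \<le> j" using assms(3,4) j by (force simp: gap_def)
  ultimately show ?thesis using j by (auto simp: le_less_Suc_eq not_le)
qed

lemma lines_distinct:
  assumes "t \<notin> c ` {1..N}" "r \<in> lines" "s \<in> lines" "r \<noteq> s"
  shows "L r t \<noteq> L s t"
  using diagram assms unfolding wiring_diagram_def inj_on_def by blast

text \<open>Invariant of the induction over the crossings: over \<open>gap k\<close>, the line in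
  position \<open>a\<close> from the top is \<open>w k a\<close>.\<close>

definition ordered :: "nat \<Rightarrow> bool" where
  "ordered k \<longleftrightarrow> (\<forall>t\<in>gap k. \<forall>a\<in>lines. \<forall>b\<in>lines. a < b \<longrightarrow> L (w k b) t < L (w k a) t)"

lemma line_position_gap:
  assumes "ordered k" "k \<le> N" "t \<in> gap k" "a \<in> lines"
  shows "line_position n L t (w k a) = a"
proof -
  have less: "L (w k a) t < L (w k b) t \<longleftrightarrow> b < a" if "b \<in> lines" for b
    using assms that unfolding ordered_def
    by (metis less_asym linorder_less_linear)
  have "{r \<in> lines. L (w k a) t < L r t} = w k ` {1..<a}" (is "?A = ?B")
  proof
    show "?A \<subseteq> ?B"
    proof
      fix r assume r: "r \<in> ?A"
      then obtain b where b: "b \<in> lines" "r = w k b" using w_obtain[OF assms(2)] by blast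
      with r less[of b] show "r \<in> ?B" by auto
    qed
    show "?B \<subseteq> ?A"
      using less w_mem[OF assms(2)] assms(4) by force
  qed
  moreover have "card (w k ` {1..<a}) = a - 1"
    by (subst card_image) (auto simp: inj_on_def w_eq_iff)
  ultimately show ?thesis using assms(4) by (simp add: line_position_def)
qed

text \<open>Passing to a lower line can only add lines strictly above it, so a smaller position
  forces a greater height.\<close>

lemma line_position_less:
  assumes "line_position n L t q < line_position n L t p"
  shows "L p t < L q t"
proof (rule ccontr)
  assume "\<not> L p t < L q t"
  then have "{r \<in> lines. L r t > L p t} \<subseteq> {r \<in> lines. L r t > L q t}" by auto
  then have "line_position n L t p \<le> line_position n L t q"
    unfolding line_position_def by (intro add_right_mono card_mono) auto
  with assms show False by simp
qed

lemma crossing: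
  assumes "ordered k" and k: "k < N"
  defines "p \<equiv> w k (i (Suc k))" and "q \<equiv> w k (i (Suc k) + 1)"
  shows "L p (c (Suc k)) = L q (c (Suc k))"
    and "r \<in> lines \<Longrightarrow> s \<in> lines \<Longrightarrow> r \<noteq> s \<Longrightarrow> L r (c (Suc k)) = L s (c (Suc k)) \<Longrightarrow> {r, s} = {p, q}"
    and "\<forall>\<^sub>F t in at_right (c (Suc k)). L p t < L q t"
proof -
  have "crosses_at n L (x (Suc k)) (i (Suc k))"
    using diagram k by (simp add: wiring_diagram_def)
  then obtain p' q' where lines: "p' \<in> lines" "q' \<in> lines"
    and meet: "x (Suc k) \<in> pseudo_line L p'" "x (Suc k) \<in> pseudo_line L q'"
    and left: "\<forall>\<^sub>F t in at_left (c (Suc k)). line_position n L t p' = i (Suc k) \<and>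
      line_position n L t q' = i (Suc k) + 1"
    and right: "\<forall>\<^sub>F t in at_right (c (Suc k)). line_position n L t p' = i (Suc k) + 1 \<and>
      line_position n L t q' = i (Suc k)"
    and only: "\<forall>r\<in>lines. \<forall>s\<in>lines. r \<noteq> s \<and> L r (c (Suc k)) = L s (c (Suc k)) \<longrightarrow> {r, s} = {p', q'}"
    unfolding crosses_at_def by blast
  \<comment> \<open>An abscissa in \<open>gap k\<close> close enough to the crossing: there
    \<open>line_position_gap\<close> identifies the two unnamed lines of \<open>crosses_at\<close>
    by their positions.\<close>
  obtain t where t: "t \<in> gap k" "line_position n L t p' = i (Suc k)"
    "line_position n L t q' = i (Suc k) + 1"
    using eventually_happens[OF eventually_conj[OF left eventually_gap_left[OF k]]] by auto
  have kN: "k \<le> N" using k by simp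
  have pq: "p' = p" "q' = q"
    using line_position_gap[OF assms(1) kN t(1)] w_obtain[OF kN lines(1)] w_obtain[OF kN lines(2)] t
    unfolding p_def q_def by metis+
  show "L p (c (Suc k)) = L q (c (Suc k))"
    using meet pq by (auto simp: pseudo_line_def)
  show "{r, s} = {p, q}"
    if "r \<in> lines" "s \<in> lines" "r \<noteq> s" "L r (c (Suc k)) = L s (c (Suc k))"
    using only that pq by blast
  show "\<forall>\<^sub>F t in at_right (c (Suc k)). L p t < L q t"
    using right by eventually_elim (auto simp: pq intro: line_position_less)
qed

lemma less_connected:
  assumes "connected A" "r \<in> lines" "s \<in> lines" "\<And>t. t \<in> A \<Longrightarrow> L r t \<noteq> L s t"
    and "u \<in> A" "t \<in> A" "L r u < L s u"
  shows "L r t < L s t"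
  using continuous_less_connected[OF assms(1) cont[OF assms(2)] cont[OF assms(3)] assms(4-7)] .

text \<open>At crossing \<open>Suc k\<close> the exchanged pair gets its new order from the
  condition on the right and keeps it throughout the gap. Any other pair does not meet on the way
  from \<open>gap k\<close> to \<open>gap (Suc k)\<close> and keeps its order.\<close>

lemma ordered_all: "k \<le> N \<Longrightarrow> ordered k"
proof (induction k)
  case 0
  have "L (w 0 b) t < L (w 0 a) t"
    if "t \<in> gap 0" "a \<in> lines" "b \<in> lines" "a < b" for t a b
  proof -
    have "\<forall>k\<in>{1..N}. t < c k" using that(1) by (auto simp: gap_def)
    then show ?thesis using diagram that unfolding wiring_diagram_def by simp
  qed
  then show ?case by (simp add: ordered_def)
next
  case (Suc k)
  then have k: "k < N" "k \<le> N" and ord: "ordered k" by auto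
  define l where "l = i (Suc k)"
  have l: "l \<in> {1..n}" using letter[of "Suc k"] k by (simp add: l_def)
  note cross = crossing[OF ord k(1), folded l_def]
  have "L (w (Suc k) b) t < L (w (Suc k) a) t"
    if t: "t \<in> gap (Suc k)" and ab: "a \<in> lines" "b \<in> lines" "a < b" for t a b
  proof (cases "a = l \<and> b = Suc l")
    case True
    have w: "w (Suc k) a = w k (l + 1)" "w (Suc k) b = w k l"
      using True by (simp_all add: simple_reflection_def l_def)
    have mem: "w k (l + 1) \<in> lines" "w k l \<in> lines"
      using w_mem[OF k(2), of "l + 1"] w_mem[OF k(2), of l] l by auto
    obtain u where "u \<in> gap (Suc k)" "L (w k l) u < L (w k (l + 1)) u"
      using eventually_happens[OF eventually_conj[OF cross(3) eventually_gap_right[OF k(1)]]] by auto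
    then show ?thesis
      unfolding w using mem
      by (intro less_connected[OF connected_gap mem(2,1) lines_distinct _ t])
        (auto simp: w_eq_iff dest: gap_not_crossing)
  next
    case False
    \<comment> \<open>The positions of the two lines before the crossing; an adjacent exchange
      reverses only the pair that it exchanges.\<close>
    define a' b' where "a' = swap l (Suc l) a" "b' = swap l (Suc l) b"
    have w: "w (Suc k) a = w k a'" "w (Suc k) b = w k b'"
      by (simp_all add: simple_reflection_def l_def a'_b'_def)
    have less: "a' < b'" unfolding a'_b'_def using transpose_Suc_less[OF ab(3) False] .
    have ab': "a' \<in> lines" "b' \<in> lines"
      using ab l by (auto simp: a'_b'_def Transposition.transpose_def)
    have mem: "w k a' \<in> lines" "w k b' \<in> lines" using ab' w_mem[OF k(2)] by blast+
    \<comment> \<open>Otherwise \<open>a\<close> would be \<open>Suc l\<close> and \<open>b\<close>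
      would be \<open>l\<close>, against \<open>a < b\<close>.\<close>
    have "\<not> (a' = l \<and> b' = Suc l)"
      using ab(3) by (auto simp: a'_b'_def Transposition.transpose_def split: if_splits)
    then have ne: "{w k b', w k a'} \<noteq> {w k l, w k (l + 1)}"
      using less by (auto simp: doubleton_eq_iff w_eq_iff)
    obtain u where u: "u \<in> gap k"
      using eventually_happens[OF eventually_gap_left[OF k(1)]] by auto
    have "u \<le> t" using u t k by (force simp: gap_def)
    \<comment> \<open>\<open>Suc k\<close> is the only crossing over this segment, and only the
      lines in positions \<open>l\<close> and \<open>l + 1\<close> meet there.\<close>
    have no_meet: "L (w k b') s \<noteq> L (w k a') s" if "s \<in> {u..t}" for s
    proof (cases "s \<in> c ` {1..N}")
      case True
      then have "s = c (Suc k)" using between_gaps[OF k(1) u t that] by simp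
      then show ?thesis using cross(2)[OF mem(2,1)] ne less by (auto simp: w_eq_iff)
    next
      case False
      then show ?thesis using lines_distinct[OF False mem(2,1)] less by (auto simp: w_eq_iff)
    qed
    have "L (w k b') u < L (w k a') u" using ord u ab' less unfolding ordered_def by blast
    from less_connected[OF connected_Icc mem(2,1) no_meet _ _ this] show ?thesis
      using \<open>u \<le> t\<close> unfolding w by simp
  qed
  then show ?case by (simp add: ordered_def)
qed

lemma order_gap:
  assumes "k \<le> N" "t \<in> gap k" "a \<in> lines" "b \<in> lines"
  shows "L (w k b) t < L (w k a) t \<longleftrightarrow> a < b"
  using ordered_all[OF assms(1)] assms unfolding ordered_def
  by (metis less_asym linorder_less_linear)

section \<open>Meetings of two given lines\<close>

lemmas crossing_meet = crossing(1)[OF ordered_all]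
  and crossing_only = crossing(2)[OF ordered_all]

text \<open>Heights are distinct off the crossings, and at a crossing only the exchanged pair
  coincides.\<close>

lemma meet_imp_crossing:
  assumes "r \<in> lines" "s \<in> lines" "r \<noteq> s" "L r t = L s t"
  obtains k where "k < N" "t = c (Suc k)" "{r, s} = {w k (i (Suc k)), w k (i (Suc k) + 1)}"
proof -
  have "t \<in> c ` {1..N}" using lines_distinct assms by blast
  then obtain j where "j \<in> {1..N}" "t = c j" by blast
  then have k: "j - 1 < N" "t = c (Suc (j - 1))" by auto
  show thesis
    using that[OF k crossing_only[OF less_imp_le[OF k(1)] k(1) assms(1-3)]] assms(4)
    unfolding k(2) .
qed

text \<open>Here reducedness enters: two meetings would be two letters of the word with the same
  reflection.\<close>

lemma meet_unique:
  assumes "r \<in> lines" "s \<in> lines" "r \<noteq> s" "L r t = L s t" "L r u = L s u"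
  shows "t = u"
proof -
  obtain j where j: "j < N" "t = c (Suc j)" "{r, s} = {w j (i (Suc j)), w j (i (Suc j) + 1)}"
    using meet_imp_crossing[OF assms(1-4)] .
  obtain k where k: "k < N" "u = c (Suc k)" "{r, s} = {w k (i (Suc k)), w k (i (Suc k) + 1)}"
    using meet_imp_crossing[OF assms(1-3) assms(5)] .
  have "j = k"
    using reduced_expression_reflections_distinct[OF reduced, of j k]
      reduced_expression_reflections_distinct[OF reduced, of k j] j k
    by (cases j k rule: linorder_cases) auto
  with j k show ?thesis by simp
qed

lemma ex_meet:
  assumes "r \<in> lines" "s \<in> lines" "connected A" "t \<in> A" "u \<in> A" "L s t < L r t" "L r u \<le> L s u"
  shows "\<exists>v\<in>A. L r v = L s v"
  using less_connected[OF assms(3,2,1) _ assms(4,5,6)] assms(7) by force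

text \<open>For excluding that two lines merely touch without changing sides.\<close>

lemma crossing_less:
  assumes k: "k < N"
  defines "p \<equiv> w k (i (Suc k))" and "q \<equiv> w k (i (Suc k) + 1)"
  shows "p \<in> lines" and "q \<in> lines"
    and "t \<in> gap k \<Longrightarrow> L q t < L p t"
    and "t \<in> gap (Suc k) \<Longrightarrow> L p t < L q t"
proof -
  have l: "i (Suc k) \<in> lines" "i (Suc k) + 1 \<in> lines" using letter[of "Suc k"] k by auto
  show "p \<in> lines" "q \<in> lines" unfolding p_def q_def using w_mem[OF less_imp_le[OF k]] l by blast+
  show "L q t < L p t" if "t \<in> gap k"
    unfolding p_def q_def using order_gap[OF _ that l] k by simp
  have "w (Suc k) (i (Suc k)) = q" "w (Suc k) (i (Suc k) + 1) = p"
    by (simp_all add: p_def q_def simple_reflection_def)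
  then show "L p t < L q t" if "t \<in> gap (Suc k)"
    using order_gap[OF _ that l] k by simp
qed

text \<open>If \<open>r\<close> were above \<open>s\<close> at \<open>t1\<close> and
  \<open>t3\<close> but not at \<open>t2\<close> in between, there would be a meeting on each side
  of \<open>t2\<close>. Meetings being unique, both lie at \<open>t2\<close>, so the lines would
  touch there without changing sides, which a crossing excludes.\<close>

lemma is_interval_above:
  assumes rs: "r \<in> lines" "s \<in> lines"
  shows "is_interval {t. L s t < L r t}"
proof -
  have False if t: "t1 \<le> t2" "t2 \<le> t3" "L s t1 < L r t1" "L s t3 < L r t3" "L r t2 \<le> L s t2"
    for t1 t2 t3
  proof -
    have ne: "r \<noteq> s" using t by auto
    obtain u1 where u1: "u1 \<in> {t1..t2}" "L r u1 = L s u1"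
      using ex_meet[OF rs connected_Icc[of t1 t2], of t1 t2] t by auto
    obtain u3 where u3: "u3 \<in> {t2..t3}" "L r u3 = L s u3"
      using ex_meet[OF rs connected_Icc[of t2 t3], of t3 t2] t by auto
    have "u1 = u3" using meet_unique[OF rs ne u1(2) u3(2)] .
    with u1 u3 have meet2: "L r t2 = L s t2" by (metis atLeastAtMost_iff order_antisym)
    have no_meet: "L s v \<noteq> L r v" if "v \<noteq> t2" for v
      using meet_unique[OF rs ne meet2, of v] that by auto
    obtain k where k: "k < N" "t2 = c (Suc k)" "{r, s} = {w k (i (Suc k)), w k (i (Suc k) + 1)}"
      using meet_imp_crossing[OF rs ne meet2] .
    have "t1 < t2" "t2 < t3" using t meet2 by (auto simp: le_less)
    \<comment> \<open>Neighbours \<open>v1\<close> and \<open>v3\<close> of \<open>t2\<close> in the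
      two adjoining gaps: with no meeting between \<open>t1\<close> and \<open>v1\<close> or between
      \<open>v3\<close> and \<open>t3\<close>, \<open>r\<close> is above \<open>s\<close> at both,
      whereas the crossing reverses the order.\<close>
    obtain v1 where v1: "v1 \<in> gap k" "t1 < v1" "v1 < t2"
    proof -
      have "\<forall>\<^sub>F v in at_left t2. v \<in> gap k \<and> t1 < v \<and> v < t2"
        using eventually_gap_left[OF k(1)] order_tendstoD(1)[OF tendsto_ident_at \<open>t1 < t2\<close>]
        by (intro eventually_conj) (simp_all add: k(2), simp add: eventually_at_filter)
      then show thesis using that eventually_happens by fastforce
    qed
    obtain v3 where v3: "v3 \<in> gap (Suc k)" "t2 < v3" "v3 < t3"
    proof -
      have "\<forall>\<^sub>F v in at_right t2. v \<in> gap (Suc k) \<and> t2 < v \<and> v < t3"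
        using eventually_gap_right[OF k(1)] order_tendstoD(2)[OF tendsto_ident_at \<open>t2 < t3\<close>]
        by (intro eventually_conj) (auto simp: k(2) eventually_at_right_less)
      then show thesis using that eventually_happens by fastforce
    qed
    have "L s v1 < L r v1"
      by (rule less_connected[OF connected_Icc[of t1 v1] rs(2,1), of t1]) (use v1 t no_meet in auto)
    moreover have "L s v3 < L r v3"
      by (rule less_connected[OF connected_Icc[of v3 t3] rs(2,1), of t3]) (use v3 t no_meet in auto)
    ultimately show False
      using crossing_less(3)[OF k(1) v1(1)] crossing_less(4)[OF k(1) v3(1)] k(3)
      by (auto simp: doubleton_eq_iff)
  qed
  then show ?thesis unfolding is_interval_1 by (force simp: not_less[symmetric])
qed

section \<open>Zones as regions with a given label\<close>

text \<open>For \<open>S \<subseteq> lines\<close>, the points off the lines with label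
  \<open>S\<close>; possibly empty, as not every set of lines is a label.\<close>

definition region :: "nat set \<Rightarrow> (real \<times> real) set" where
  "region S = {P. \<forall>m\<in>lines. if m \<in> S then snd P < L m (fst P) else L m (fst P) < snd P}"

lemma region_above: "P \<in> region S \<Longrightarrow> m \<in> lines \<Longrightarrow> m \<in> S \<Longrightarrow> snd P < L m (fst P)"
  and region_below: "P \<in> region S \<Longrightarrow> m \<in> lines \<Longrightarrow> m \<notin> S \<Longrightarrow> L m (fst P) < snd P"
  unfolding region_def mem_Collect_eq by (drule (1) bspec; simp)+

lemma open_above: "m \<in> lines \<Longrightarrow> open {P. snd P < L m (fst P)}"
  and open_below: "m \<in> lines \<Longrightarrow> open {P. L m (fst P) < snd P}"
  by (auto intro!: open_Collect_less continuous_intros continuous_on_compose2[OF cont[of m UNIV]])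

lemma closed_above: "m \<in> lines \<Longrightarrow> closed {P. snd P \<le> L m (fst P)}"
  and closed_below: "m \<in> lines \<Longrightarrow> closed {P. L m (fst P) \<le> snd P}"
  by (auto intro!: closed_Collect_le continuous_intros continuous_on_compose2[OF cont[of m UNIV]])

lemma open_region: "open (region S)"
proof -
  have "region S = (\<Inter>m\<in>lines.
      if m \<in> S then {P. snd P < L m (fst P)} else {P. L m (fst P) < snd P})"
    by (auto simp: region_def split: if_splits)
  also have "open \<dots>" using open_above open_below by (intro open_INT) auto
  finally show ?thesis .
qed

lemma closure_region:
  assumes "m \<in> lines" "P \<in> closure (region S)"
  shows "m \<in> S \<Longrightarrow> snd P \<le> L m (fst P)" and "m \<notin> S \<Longrightarrow> L m (fst P) \<le> snd P"
proof -
  have "closure (region S) \<subseteq> {P. snd P \<le> L m (fst P)}" if "m \<in> S"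
    using closed_above[OF assms(1)] assms(1) that
    by (intro closure_minimal) (auto dest: region_above)
  then show "m \<in> S \<Longrightarrow> snd P \<le> L m (fst P)" using assms(2) by blast
  have "closure (region S) \<subseteq> {P. L m (fst P) \<le> snd P}" if "m \<notin> S"
    using closed_below[OF assms(1)] assms(1) that
    by (intro closure_minimal) (auto dest: region_below)
  then show "m \<notin> S \<Longrightarrow> L m (fst P) \<le> snd P" using assms(2) by blast
qed

text \<open>For \<open>S \<subseteq> lines\<close> this is the projection of \<open>region S\<close>
  to the abscissas, expressed by the lines alone: \<open>S\<close> has to consist of the uppermost
  lines. In this form it is an intersection of sets from \<open>is_interval_above\<close>, hence an
  interval.\<close>

definition shadow :: "nat set \<Rightarrow> real set" where
  "shadow S = {t. \<forall>s\<in>S. \<forall>r\<in>lines - S. L r t < L s t}"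

lemma fst_region:
  assumes "S \<subseteq> lines"
  shows "fst ` region S = shadow S"
proof
  show "fst ` region S \<subseteq> shadow S"
  proof safe
    fix t y assume ty: "(t, y) \<in> region S"
    have "L r t < L s t" if "s \<in> S" "r \<in> lines - S" for r s
    proof -
      have "s \<in> lines" "r \<in> lines" "r \<notin> S" using that assms by auto
      then have "L r t < y" "y < L s t" 
        using region_above[OF ty] region_below[OF ty] \<open>s \<in> S\<close> by auto
      then show ?thesis by simp
    qed
    then show "fst (t, y) \<in> shadow S" by (simp add: shadow_def)
  qed
next
  have fin: "finite S" using assms finite_subset by blast
  show "shadow S \<subseteq> fst ` region S"
  proof
    fix t assume "t \<in> shadow S"
    \<comment> \<open>Finitely many lines leave room for a height between those outside
      \<open>S\<close> and those in \<open>S\<close>.\<close>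
    then obtain y where "\<forall>a\<in>(\<lambda>r. L r t) ` (lines - S). a < y" "\<forall>b\<in>(\<lambda>s. L s t) ` S. y < b"
      using ex_real_between_finite_sets[of "(\<lambda>r. L r t) ` (lines - S)" "(\<lambda>s. L s t) ` S"] fin
      by (auto simp: shadow_def)
    then have "(t, y) \<in> region S" by (auto simp: region_def)
    then show "t \<in> fst ` region S" by force
  qed
qed

lemma is_interval_shadow:
  assumes "S \<subseteq> lines"
  shows "is_interval (shadow S)"
proof -
  have "shadow S = (\<Inter>s\<in>S. \<Inter>r\<in>lines - S. {t. L r t < L s t})"
    by (auto simp: shadow_def)
  also have "is_interval \<dots>"
    using is_interval_above assms unfolding is_interval_convex_1 by (intro convex_INT) blast
  finally show ?thesis .
qed

lemma open_shadow: "S \<subseteq> lines \<Longrightarrow> open (shadow S)"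
  using open_image_fst[OF open_region[of S]] fst_region by simp

lemma region_empty_iff: "S \<subseteq> lines \<Longrightarrow> region S = {} \<longleftrightarrow> shadow S = {}"
  using fst_region by (metis image_is_empty)

lemma connected_region:
  assumes "S \<subseteq> lines"
  shows "connected (region S)"
proof (rule connected_if_connected_sections[OF open_region])
  show "connected (fst ` region S)"
    using is_interval_shadow[OF assms] by (simp add: fst_region[OF assms] is_interval_connected_1)
  fix t
  have "{y. (t, y) \<in> region S} = (\<Inter>m\<in>lines. if m \<in> S then {..<L m t} else {L m t<..})"
    by (auto simp: region_def split: if_splits)
  also have "convex \<dots>" by (intro convex_INT) (auto intro: convex_real_interval)
  finally show "connected {y. (t, y) \<in> region S}" by (rule convex_connected)
qed

lemma region_label:
  assumes "S \<subseteq> lines" "P \<in> region S"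
  shows "S = {m \<in> lines. snd P < L m (fst P)}"
  using region_above[OF assms(2)] region_below[OF assms(2)] assms(1) by (auto dest: less_asym)

text \<open>A partition of the complement of the lines into open connected nonempty sets is its set
  of components. Disjointness holds because a point determines its label.\<close>

lemma zones_eq: "zones n L = {region S | S. S \<subseteq> lines \<and> region S \<noteq> {}}" (is "_ = ?R")
  unfolding zones_def
proof (rule components_open_unique)
  show "pairwise disjnt ?R"
  proof (rule pairwiseI)
    fix X Y assume XY: "X \<in> ?R" "Y \<in> ?R" "X \<noteq> Y"
    then obtain S S' where S: "X = region S" "S \<subseteq> lines" "Y = region S'" "S' \<subseteq> lines" by blast
    have "S = S'" if "P \<in> X" "P \<in> Y" for P
      using region_label[of S P] region_label[of S' P] S that by simp
    then show "disjnt X Y" using XY S by (auto simp: disjnt_iff)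
  qed
  show "\<Union>?R = - (\<Union>m\<in>lines. pseudo_line L m)"
  proof (intro equalityI subsetI)
    fix P assume "P \<in> \<Union>?R"
    then obtain S where P: "P \<in> region S" by blast
    show "P \<in> - (\<Union>m\<in>lines. pseudo_line L m)"
    proof
      assume "P \<in> (\<Union>m\<in>lines. pseudo_line L m)"
      then obtain m where "m \<in> lines" "snd P = L m (fst P)" by (auto simp: pseudo_line_def)
      with region_above[OF P] region_below[OF P] show False by (metis less_irrefl)
    qed
  next
    fix P assume P: "P \<in> - (\<Union>m\<in>lines. pseudo_line L m)"
    have "L m (fst P) \<noteq> snd P" if "m \<in> lines" for m
      using P that by (cases P) (auto simp: pseudo_line_def)
    then have "P \<in> region {m \<in> lines. snd P < L m (fst P)}"
      by (auto simp: region_def not_less le_less)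
    moreover have "{m \<in> lines. snd P < L m (fst P)} \<subseteq> lines" by blast
    ultimately show "P \<in> \<Union>?R" by blast
  qed
  show "open X \<and> connected X \<and> X \<noteq> {}" if "X \<in> ?R" for X
    using that open_region connected_region by blast
qed

lemma label_region:
  assumes "S \<subseteq> lines" "region S \<noteq> {}"
  shows "label n L (region S) = S"
proof
  obtain P where P: "P \<in> region S" using assms(2) by blast
  show "label n L (region S) \<subseteq> S"
    using P region_label[OF assms(1) P] by (auto simp: label_def)
  show "S \<subseteq> label n L (region S)"
    using assms(1) region_above unfolding label_def by fastforce
qed

section \<open>Labels over a gap and the zone starting at a crossing\<close>

lemma shadowD: "t \<in> shadow S \<Longrightarrow> s \<in> S \<Longrightarrow> r \<in> lines \<Longrightarrow> r \<notin> S \<Longrightarrow> L r t < L s t"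
  unfolding shadow_def by blast

lemma shadow_top:
  assumes "k \<le> N" "t \<in> gap k" "l \<le> n + 1"
  shows "t \<in> shadow (w k ` {1..l})"
proof -
  have "L r t < L s t" if s: "s \<in> w k ` {1..l}" and r: "r \<in> lines - w k ` {1..l}" for r s
  proof -
    obtain a where a: "s = w k a" "a \<in> {1..l}" using s by blast
    obtain b where b: "r = w k b" "b \<in> lines" using w_obtain[OF assms(1)] r by blast
    have "a \<in> lines" "a < b" using a b r assms(3) by (auto simp: w_eq_iff)
    then show ?thesis using order_gap[OF assms(1,2) _ b(2)] a b by blast
  qed
  then show ?thesis by (simp add: shadow_def)
qed

lemma top_subset_lines: "k \<le> N \<Longrightarrow> l \<le> n + 1 \<Longrightarrow> w k ` {1..l} \<subseteq> lines"
  using w_mem[of k] by fastforce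

text \<open>With a line, \<open>S\<close> contains every line above it, so the positions held by
  \<open>S\<close> form an initial segment. The value \<open>l = 0\<close> belongs to the region
  above all lines.\<close>

lemma shadow_gap:
  assumes "k \<le> N" "t \<in> gap k" "t \<in> shadow S" "S \<subseteq> lines"
  shows "\<exists>l\<le>n + 1. S = w k ` {1..l}"
proof -
  define A where "A = {a \<in> lines. w k a \<in> S}"
  have "S \<subseteq> w k ` lines" using assms(4) w_image[OF assms(1)] by simp
  then have S: "S = w k ` A" by (auto simp: A_def)
  have down: "b \<in> A" if "a \<in> A" "b \<in> lines" "b < a" for a b
  proof (rule ccontr)
    assume "b \<notin> A"
    then have "w k b \<in> lines - S" using that w_mem[OF assms(1)] by (auto simp: A_def)
    then have "L (w k b) t < L (w k a) t" using that assms(3) by (auto simp: shadow_def A_def)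
    then show False using order_gap[OF assms(1,2), of a b] that by (auto simp: A_def)
  qed
  show ?thesis
  proof (cases "A = {}")
    case True
    then show ?thesis using S by (intro exI[of _ 0]) auto
  next
    case False
    have fin: "finite A" by (simp add: A_def)
    have max: "Max A \<in> A" using Max_in[OF fin False] .
    have "A = {1..Max A}"
    proof
      show "A \<subseteq> {1..Max A}" using Max_ge[OF fin] by (auto simp: A_def)
      show "{1..Max A} \<subseteq> A"
      proof
        fix b assume b: "b \<in> {1..Max A}"
        then have "b \<in> lines" using max by (auto simp: A_def)
        then show "b \<in> A" using down[OF max] max b by (cases "b = Max A") auto
      qed
    qed
    moreover have "Max A \<le> n + 1" using max by (auto simp: A_def)
    ultimately show ?thesis using S by metis
  qed
qed

text \<open>\<open>S\<close> collects the lines down to the upper one of the exchanged pair after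
  the crossing. Before the crossing this pair is in the opposite order, so the region cannot reach
  there; from the right it narrows down to the crossing point between the two lines.\<close>

lemma leftmost_region:
  assumes k: "k < N"
  defines "S \<equiv> w (Suc k) ` {1..i (Suc k)}"
  shows "leftmost_point (region S) (x (Suc k))" and "S \<subseteq> lines"
proof -
  define l where "l = i (Suc k)"
  define p q where "p = w k l" and "q = w k (l + 1)"
  have l: "l \<in> {1..n}" using letter[of "Suc k"] k by (simp add: l_def)
  note less = crossing_less[OF k, folded l_def, folded p_def q_def]
  show S: "S \<subseteq> lines" using top_subset_lines[of "Suc k" l] k l by (simp add: S_def l_def)
  \<comment> \<open>After the crossing \<open>q\<close> is the lowest line of \<open>S\<close> and
    \<open>p\<close> the highest line outside \<open>S\<close>.\<close>
  have pq: "q = w (Suc k) l" "p = w (Suc k) (l + 1)"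
    by (simp_all add: p_def q_def simple_reflection_def l_def)
  have q: "q \<in> S" and p: "p \<notin> S"
    using l by (auto simp: S_def pq w_eq_iff simp flip: l_def simp del: word_prod.simps)
  have meet: "L p (c (Suc k)) = L q (c (Suc k))"
    using crossing_meet[of k] k by (simp add: p_def q_def l_def)
  \<comment> \<open>\<open>crosses_at\<close> does not name its two lines; as only one pair meets
    over the crossing, they are \<open>p\<close> and \<open>q\<close>.\<close>
  have snd_x: "snd (x (Suc k)) = L q (c (Suc k))"
  proof -
    have "crosses_at n L (x (Suc k)) l"
      using diagram k by (simp add: wiring_diagram_def l_def)
    then obtain p' q' where pq': "p' \<in> lines" "q' \<in> lines"
      "x (Suc k) \<in> pseudo_line L p'" "x (Suc k) \<in> pseudo_line L q'"
      "\<forall>r\<in>lines. \<forall>s\<in>lines. r \<noteq> s \<and> L r (c (Suc k)) = L s (c (Suc k)) \<longrightarrow> {r, s} = {p', q'}"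
      unfolding crosses_at_def by blast
    have "p \<noteq> q" by (simp add: p_def q_def w_eq_iff)
    then have "{p, q} = {p', q'}" using pq'(5) less(1,2) meet by blast
    then have "q = p' \<or> q = q'" by blast
    then show ?thesis using pq'(3,4) by (auto simp: pseudo_line_def)
  qed
  have gap_shadow: "t \<in> shadow S" if "t \<in> gap (Suc k)" for t
    using shadow_top[OF _ that, of l] k l by (simp add: S_def l_def)
  have right: "c (Suc k) < t" if "t \<in> shadow S" for t
  proof (rule ccontr)
    assume "\<not> c (Suc k) < t"
    \<comment> \<open>A point of \<open>gap k\<close>, to the right of \<open>t\<close> unless
      \<open>t\<close> is the crossing abscissa itself. The shadow, being an interval, would contain
      \<open>u\<close> or the crossing abscissa, and at neither is \<open>q\<close> above
      \<open>p\<close>.\<close>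
    obtain u where u: "u \<in> gap k" "u < c (Suc k)" "t < c (Suc k) \<longrightarrow> t < u"
    proof -
      have "\<forall>\<^sub>F u in at_left (c (Suc k)). t < c (Suc k) \<longrightarrow> t < u"
        using order_tendstoD(1)[OF tendsto_ident_at, of t "c (Suc k)"]
        by (cases "t < c (Suc k)") auto
      then have "\<forall>\<^sub>F u in at_left (c (Suc k)). u \<in> gap k \<and> u < c (Suc k) \<and> (t < c (Suc k) \<longrightarrow> t < u)"
        using eventually_gap_left[OF k]
        by (intro eventually_conj) (simp_all, simp add: eventually_at_filter)
      then show thesis using that eventually_happens by fastforce
    qed
    obtain v where v: "v \<in> gap (Suc k)" "c (Suc k) < v"
      using eventually_happens[OF eventually_conj[OF eventually_gap_right[OF k] eventually_at_right_less]]
      by auto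
    have "u \<in> shadow S" if "t < c (Suc k)"
      using mem_is_interval_1_I[OF is_interval_shadow[OF S] \<open>t \<in> shadow S\<close> gap_shadow[OF v(1)], of u]
        that u v by simp
    moreover have "c (Suc k) \<in> shadow S" if "t = c (Suc k)"
      using \<open>t \<in> shadow S\<close> that by simp
    moreover have "u \<notin> shadow S"
      using less(3)[OF u(1)] shadowD[OF _ q less(1) p, of u] by auto
    moreover have "c (Suc k) \<notin> shadow S"
      using meet shadowD[OF _ q less(1) p, of "c (Suc k)"] by auto
    ultimately show False using \<open>\<not> c (Suc k) < t\<close> by linarith
  qed
  \<comment> \<open>The point midway between the two lines tends to the crossing point from within
    the region.\<close>
  have "((\<lambda>t. (t, (L p t + L q t) / 2)) \<longlongrightarrow> (c (Suc k), (L p (c (Suc k)) + L q (c (Suc k))) / 2))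
      (at_right (c (Suc k)))"
    using less(1,2)
    by (intro tendsto_intros continuous_on_tendsto_compose[OF cont[of _ UNIV]]) auto
  moreover have "(c (Suc k), (L p (c (Suc k)) + L q (c (Suc k))) / 2) = x (Suc k)"
    using snd_x meet by (simp add: prod_eq_iff)
  moreover have "\<forall>\<^sub>F t in at_right (c (Suc k)). (t, (L p t + L q t) / 2) \<in> closure (region S)"
    using eventually_gap_right[OF k]
  proof eventually_elim
    case (elim t)
    have kN: "Suc k \<le> N" using k by simp
    have "if m \<in> S then L q t \<le> L m t else L m t \<le> L p t" if "m \<in> lines" for m
    proof -
      obtain b where b: "b \<in> lines" "m = w (Suc k) b" using w_obtain[OF kN \<open>m \<in> lines\<close>] .
      have "m \<in> S \<longleftrightarrow> b \<le> l"
        using b by (auto simp: S_def w_eq_iff simp flip: l_def simp del: word_prod.simps)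
      moreover have "L m t < L q t \<longleftrightarrow> l < b"
        using order_gap[OF kN elim, of l b] b l by (simp add: pq del: word_prod.simps)
      moreover have "L p t < L m t \<longleftrightarrow> b < l + 1"
        using order_gap[OF kN elim, of b "l + 1"] b l by (simp add: pq del: word_prod.simps)
      ultimately show ?thesis by auto
    qed
    then have "(t, (L p t + L q t) / 2) \<in> region S"
      using less(4)[OF elim] unfolding region_def by (fastforce split: if_splits)
    then show ?case using closure_subset by blast
  qed
  ultimately have "x (Suc k) \<in> closure (region S)"
    using Lim_in_closed_set[OF closed_closure _ trivial_limit_at_right_real] by metis
  moreover have "c (Suc k) < fst P" if P: "P \<in> closure (region S)" "P \<noteq> x (Suc k)" for P
  proof -
    have "region S \<subseteq> {P. c (Suc k) \<le> fst P}"
      using right fst_region[OF S] by (fastforce intro: less_imp_le)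
    moreover have "closed {P::real \<times> real. c (Suc k) \<le> fst P}"
      by (intro closed_Collect_le continuous_intros)
    ultimately have "c (Suc k) \<le> fst P" using P(1) closure_minimal by blast
    \<comment> \<open>Over the crossing abscissa the closure is squeezed between \<open>L p\<close>
      and \<open>L q\<close>, which agree there.\<close>
    moreover have "fst P \<noteq> c (Suc k)"
    proof
      assume "fst P = c (Suc k)"
      moreover from this have "snd P = snd (x (Suc k))"
        using closure_region[OF less(1) P(1)] closure_region[OF less(2) P(1)] p q meet snd_x by auto
      ultimately show False using P(2) by (simp add: prod_eq_iff)
    qed
    ultimately show ?thesis by simp
  qed
  ultimately show "leftmost_point (region S) (x (Suc k))" by (simp add: leftmost_point_def)
qed

text \<open>Points of the region close to the crossing lie over \<open>gap (Suc k)\<close>, so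
  \<open>S\<close> consists of the \<open>l\<close> uppermost lines there. For \<open>l\<close>
  other than the level the crossing does not change this set, and the region would continue to the
  left.\<close>

lemma leftmost_unique:
  assumes k: "k < N" and S: "S \<subseteq> lines"
    and left: "leftmost_point (region S) (x (Suc k))"
  shows "S = w (Suc k) ` {1..i (Suc k)}"
proof -
  have kN: "k \<le> N" "Suc k \<le> N" using k by auto
  have "c (Suc k) \<le> t" if "t \<in> shadow S" for t
  proof -
    have "t \<in> fst ` region S" using that fst_region[OF S] by simp
    then obtain P where P: "P \<in> region S" "fst P = t" by auto
    then have "P \<in> closure (region S)" using closure_subset by blast
    then show ?thesis using left P(2) unfolding leftmost_point_def by (cases "P = x (Suc k)") auto
  qed
  \<comment> \<open>Openness of the shadow excludes the crossing abscissa itself.\<close>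
  then have right: "shadow S \<subseteq> {c (Suc k)<..}"
    using interior_maximal[OF _ open_shadow[OF S], of "{c (Suc k)..}"] by (auto simp: interior_real_atLeast)
  obtain b where b: "b > c (Suc k)" "\<And>t. c (Suc k) < t \<Longrightarrow> t < b \<Longrightarrow> t \<in> gap (Suc k)"
    using eventually_gap_right[OF k] unfolding eventually_at_right_field by blast
  have "x (Suc k) \<in> closure (region S)" using left by (simp add: leftmost_point_def)
  then obtain P where P: "P \<in> region S" "dist P (x (Suc k)) < b - c (Suc k)"
    using b(1) unfolding closure_approachable by (metis diff_gt_0_iff_gt)
  have t: "fst P \<in> shadow S" using P(1) fst_region[OF S] by (metis imageI)
  have "\<bar>fst P - c (Suc k)\<bar> < b - c (Suc k)"
    using dist_fst_le[of P "x (Suc k)"] P(2) by (simp add: dist_real_def)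
  then have "fst P \<in> gap (Suc k)" using b(2)[of "fst P"] right t by auto
  then obtain l where l: "l \<le> n + 1" "S = w (Suc k) ` {1..l}"
    using shadow_gap[OF kN(2) _ t S] by blast
  have "l = i (Suc k)"
  proof (rule ccontr)
    assume ne: "l \<noteq> i (Suc k)"
    have "i (Suc k) \<in> {1..n}" using letter[of "Suc k"] k by simp
    \<comment> \<open>The two exchanged positions lie both inside or both outside
      \<open>{1..l}\<close>.\<close>
    then have "simple_reflection (i (Suc k)) ` {1..l} = {1..l}"
      unfolding simple_reflection_def using ne by (intro transpose_image_eq) auto
    then have "S = w k ` {1..l}" unfolding l(2) word_prod.simps image_comp[symmetric] by simp
    moreover obtain u where u: "u \<in> gap k" "u < c (Suc k)"
    proof -
      have "\<forall>\<^sub>F u in at_left (c (Suc k)). u \<in> gap k \<and> u < c (Suc k)"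
        using eventually_gap_left[OF k]
        by (intro eventually_conj) (simp_all, simp add: eventually_at_filter)
      then show thesis using that eventually_happens by fastforce
    qed
    ultimately have "u \<in> shadow S" using shadow_top[OF kN(1) u(1) l(1)] by simp
    then show False using right u(2) by auto
  qed
  with l show ?thesis by simp
qed

text \<open>Existence and uniqueness let the definite description in \<open>zone_from\<close> denote
  this region.\<close>

lemma zone_from_crossing:
  assumes "k \<in> {1..N}"
  defines "S \<equiv> w k ` {1..i k}"
  shows "zone_from n L (x k) = region S" and "S \<subseteq> lines" and "region S \<noteq> {}"
proof -
  obtain j where j: "k = Suc j" "j < N" using assms(1) by (cases k) auto
  have left: "leftmost_point (region S) (x k)" and S: "S \<subseteq> lines"
    using leftmost_region[OF j(2)] by (simp_all only: S_def j(1))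
  then show ne: "region S \<noteq> {}" by (auto simp: leftmost_point_def)
  show "S \<subseteq> lines" by fact
  show "zone_from n L (x k) = region S"
    unfolding zone_from_def
  proof (rule the_equality)
    show "region S \<in> zones n L \<and> leftmost_point (region S) (x k)"
      using left S ne by (auto simp: zones_eq)
    fix Z assume "Z \<in> zones n L \<and> leftmost_point Z (x k)"
    then obtain S' where "Z = region S'" "S' \<subseteq> lines" "leftmost_point (region S') (x k)"
      by (auto simp: zones_eq)
    then show "Z = region S" using leftmost_unique[OF j(2)] by (simp only: S_def j(1))
  qed
qed

section \<open>Adjacency\<close>

text \<open>There are finitely many crossings; at an abscissa avoiding them all lines have distinct
  heights.\<close>

lemma ex_not_crossing:
  fixes a b :: real
  assumes "a < b"
  obtains t where "t \<in> {a<..<b}" "t \<notin> c ` {1..N}"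
proof -
  have "infinite ({a<..<b} - c ` {1..N})"
    using assms by (intro Diff_infinite_finite) (auto simp: infinite_Ioo)
  then show thesis using that by (metis Diff_iff ex_in_conv finite.emptyI)
qed

text \<open>Off the crossings the weak inequalities on the closure become strict. As the right-hand
  side does not involve \<open>S\<close>, the labels of two regions touching \<open>L m\<close> at
  the same point differ at most in \<open>m\<close>.\<close>

lemma closure_label:
  assumes "(t, L m t) \<in> closure (region S)" "t \<notin> c ` {1..N}"
    and "S \<subseteq> lines" "m \<in> lines"
  shows "S - {m} = {r \<in> lines. L m t < L r t}"
proof -
  have "r \<in> S \<longleftrightarrow> L m t < L r t" if "r \<in> lines" "r \<noteq> m" for r
    using closure_region[OF that(1) assms(1)] lines_distinct[OF assms(2,4) that(1)] that
    by fastforce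
  then show ?thesis using assms(3) by auto
qed

lemma closure_from_above:
  assumes "\<forall>\<^sub>F y in at_right (L m t). (t, y) \<in> R"
  shows "(t, L m t) \<in> closure R"
  using assms closure_subset[of R]
  by (intro Lim_in_closed_set[OF closed_closure _ trivial_limit_at_right_real, of "\<lambda>y. (t, y)"])
    (auto intro!: tendsto_intros elim: eventually_mono)

lemma closure_from_below:
  assumes "\<forall>\<^sub>F y in at_left (L m t). (t, y) \<in> R"
  shows "(t, L m t) \<in> closure R"
  using assms closure_subset[of R]
  by (intro Lim_in_closed_set[OF closed_closure _ trivial_limit_at_left_real, of "\<lambda>y. (t, y)"])
    (auto intro!: tendsto_intros elim: eventually_mono)

text \<open>Points just above and just below \<open>L m\<close> decide which label contains
  \<open>m\<close>; on all other lines the labels agree by \<open>closure_label\<close>.\<close>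

lemma passes_between_label:
  assumes S: "S \<subseteq> lines" "S' \<subseteq> lines" and m: "m \<in> lines"
    and pass: "passes_between L m (region S) (region S')"
  shows "m \<notin> S" and "S' = insert m S"
proof -
  obtain a b where ab: "a < b"
    and near: "\<And>t. t \<in> {a<..<b} \<Longrightarrow> \<forall>\<^sub>F y in at_right (L m t). (t, y) \<in> region S"
      "\<And>t. t \<in> {a<..<b} \<Longrightarrow> \<forall>\<^sub>F y in at_left (L m t). (t, y) \<in> region S'"
    using pass unfolding passes_between_def by blast
  obtain t where t: "t \<in> {a<..<b}" "t \<notin> c ` {1..N}" using ex_not_crossing[OF ab] .
  obtain y where y: "(t, y) \<in> region S" "L m t < y"
    using eventually_happens[OF eventually_conj[OF near(1)[OF t(1)] eventually_at_right_less]] by auto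
  show "m \<notin> S" using region_above[OF y(1) m] y(2) by auto
  have "\<forall>\<^sub>F y in at_left (L m t). y < L m t" by (simp add: eventually_at_filter)
  then obtain y' where y': "(t, y') \<in> region S'" "y' < L m t"
    using eventually_happens[OF eventually_conj[OF near(2)[OF t(1)]]] by fastforce
  have "m \<in> S'" using region_below[OF y'(1) m] y'(2) by auto
  moreover have "S - {m} = S' - {m}"
    using closure_label[OF closure_from_above[OF near(1)[OF t(1)]] t(2) S(1) m]
      closure_label[OF closure_from_below[OF near(2)[OF t(1)]] t(2) S(2) m] by simp
  ultimately show "S' = insert m S" using \<open>m \<notin> S\<close> by blast
qed

text \<open>Adjacency is symmetric, so the cardinalities decide which of the two labels contains
  \<open>m\<close>.\<close>

lemma adjacent_label:
  assumes S: "S \<subseteq> lines" "S' \<subseteq> lines" and card: "card S' = Suc (card S)"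
    and adj: "adjacent n L (region S) (region S')"
  shows "\<exists>m\<in>lines. m \<notin> S \<and> S' = insert m S"
proof -
  obtain m a b where m: "m \<in> lines" and ab: "a < b"
    and front: "(\<lambda>t. (t, L m t)) ` {a..b} \<subseteq> frontier (region S) \<inter> frontier (region S')"
    using adj unfolding adjacent_def by blast
  obtain t where t: "t \<in> {a<..<b}" "t \<notin> c ` {1..N}" using ex_not_crossing[OF ab] .
  then have "(t, L m t) \<in> frontier (region S) \<inter> frontier (region S')" using front by auto
  then have cl: "(t, L m t) \<in> closure (region S)" "(t, L m t) \<in> closure (region S')"
    by (auto simp: frontier_def)
  have eq: "S - {m} = S' - {m}"
    using closure_label[OF cl(1) t(2) S(1) m] closure_label[OF cl(2) t(2) S(2) m] by simp
  have fin: "finite S" "finite S'" using S finite_subset by auto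
  have "m \<in> S'"
  proof (rule ccontr)
    assume "m \<notin> S'"
    then have "S' \<subseteq> S" using eq by blast
    then show False using card_mono[OF fin(1), of S'] card by simp
  qed
  moreover have "m \<notin> S"
  proof
    assume "m \<in> S"
    then have "S = S'" using eq \<open>m \<in> S'\<close> by blast
    then show False using card by simp
  qed
  ultimately show ?thesis using eq m by blast
qed

text \<open>Over a segment joining a point of \<open>shadow S\<close> to one of \<open>shadow (insert m S)\<close>, the lines of
  \<open>S\<close> stay above all lines outside \<open>insert m S\<close>, hence \<open>L\<^sub>m\<close> lies below the former or above the
  latter. So the two open shadows cover the segment, and they overlap by connectedness.\<close>

lemma shadows_overlap:
  assumes S: "insert m S \<subseteq> lines" "m \<notin> S" and ne: "region S \<noteq> {}" "region (insert m S) \<noteq> {}"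
  shows "shadow S \<inter> shadow (insert m S) \<noteq> {}"
proof -
  have S': "S \<subseteq> lines" using S by blast
  obtain t t' where t: "t \<in> shadow S" "t' \<in> shadow (insert m S)"
    using ne region_empty_iff[OF S'] region_empty_iff[OF S(1)] by auto
  have "closed_segment t t' \<subseteq> shadow S \<union> shadow (insert m S)"
  proof
    fix u assume u: "u \<in> closed_segment t t'"
    have less: "L r u < L s u" if sr: "s \<in> S" "r \<in> lines" "r \<notin> insert m S" for s r
    proof -
      have seg: "t \<in> {v. L r v < L s v}" "t' \<in> {v. L r v < L s v}"
        using shadowD[OF t(1)] shadowD[OF t(2)] sr by auto
      have "convex {v. L r v < L s v}"
        using is_interval_above[of s r] sr S' by (auto simp: is_interval_convex_1)
      from closed_segment_subset[OF seg this] u show ?thesis by blast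
    qed
    show "u \<in> shadow S \<union> shadow (insert m S)"
    proof (rule ccontr)
      assume "u \<notin> shadow S \<union> shadow (insert m S)"
      then have out: "u \<notin> shadow S" "u \<notin> shadow (insert m S)" by simp_all
      obtain s r where sr: "s \<in> S" "r \<in> lines" "r \<notin> S" "\<not> L r u < L s u"
        using out(1) unfolding shadow_def by blast
      obtain s' r' where sr': "s' \<in> insert m S" "r' \<in> lines" "r' \<notin> insert m S" "\<not> L r' u < L s' u"
        using out(2) unfolding shadow_def by blast
      have "r = m" using less[OF sr(1,2)] sr(3,4) by blast
      moreover have "s' = m" using less[OF _ sr'(2,3), of s'] sr'(1,4) by blast
      ultimately show False using less[OF sr(1) sr'(2,3)] sr(4) sr'(4) by simp
    qed
  qed
  then show ?thesis
    using connectedD[OF connected_segment(1)[of t t'] open_shadow[OF S'] open_shadow[OF S(1)]] t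
      ends_in_segment[of t t'] by blast
qed

text \<open>Over the overlap of the two shadows \<open>L m\<close> lies strictly below the lines of
  \<open>S\<close> and strictly above the remaining ones, so small vertical steps away from it stay
  in the two regions.\<close>

lemma ex_interval_between:
  assumes S: "insert m S \<subseteq> lines" "m \<notin> S" and ne: "region S \<noteq> {}" "region (insert m S) \<noteq> {}"
  obtains a b where "a < b"
    and "\<And>t. t \<in> {a..b} \<Longrightarrow> \<forall>\<^sub>F y in at_right (L m t). (t, y) \<in> region S"
    and "\<And>t. t \<in> {a..b} \<Longrightarrow> \<forall>\<^sub>F y in at_left (L m t). (t, y) \<in> region (insert m S)"
proof -
  have S': "S \<subseteq> lines" and m: "m \<in> lines" using S by auto
  have "open (shadow S \<inter> shadow (insert m S))"
    using open_shadow[OF S'] open_shadow[OF S(1)] by (rule open_Int)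
  \<comment> \<open>A closed ball inside the open overlap, so that the segment with its endpoints
    can serve as common boundary.\<close>
  then obtain u e where e: "e > 0" "cball u e \<subseteq> shadow S \<inter> shadow (insert m S)"
    using shadows_overlap[OF assms] open_contains_cball by (metis ex_in_conv)
  have order: "if r \<in> S then L m t < L r t else r = m \<or> L r t < L m t"
    if t: "t \<in> {u - e..u + e}" and r: "r \<in> lines" for t r
  proof -
    have "t \<in> shadow S" "t \<in> shadow (insert m S)"
      using e(2) t by (auto simp: cball_eq_atLeastAtMost)
    then show ?thesis
      using shadowD[of t S r m] shadowD[of t "insert m S" m r] r m S(2) by auto
  qed
  show thesis
  proof
    show "u - e < u + e" using e(1) by simp
  next
    fix t assume t: "t \<in> {u - e..u + e}"
    have "\<forall>\<^sub>F y in at_right (L m t). if r \<in> S then y < L r t else L r t < y" if r: "r \<in> lines" for r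
    proof (cases "r \<in> S")
      case True
      then show ?thesis using order[OF t r] order_tendstoD(2)[OF tendsto_ident_at] by simp
    next
      case False
      then have "L r t \<le> L m t" using order[OF t r] by auto
      with False eventually_at_right_less[of "L m t"] show ?thesis
        by (auto elim!: eventually_mono)
    qed
    then have "\<forall>\<^sub>F y in at_right (L m t). \<forall>r\<in>lines. if r \<in> S then y < L r t else L r t < y"
      by (intro eventually_ball_finite) blast+
    then show "\<forall>\<^sub>F y in at_right (L m t). (t, y) \<in> region S"
      by (simp only: region_def mem_Collect_eq fst_conv snd_conv)
  next
    fix t assume t: "t \<in> {u - e..u + e}"
    have "\<forall>\<^sub>F y in at_left (L m t). if r \<in> insert m S then y < L r t else L r t < y"
      if r: "r \<in> lines" for r
    proof (cases "r \<in> insert m S")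
      case True
      then have "L m t \<le> L r t" using order[OF t r] by (auto split: if_splits)
      moreover have "\<forall>\<^sub>F y in at_left (L m t). y < L m t" by (simp add: eventually_at_filter)
      ultimately show ?thesis using True by (auto elim!: eventually_mono)
    next
      case False
      then have "L r t < L m t" using order[OF t r] by auto
      from order_tendstoD(1)[OF tendsto_ident_at this] False show ?thesis by simp
    qed
    then have "\<forall>\<^sub>F y in at_left (L m t).
        \<forall>r\<in>lines. if r \<in> insert m S then y < L r t else L r t < y"
      by (intro eventually_ball_finite) blast+
    then show "\<forall>\<^sub>F y in at_left (L m t). (t, y) \<in> region (insert m S)"
      by (simp only: region_def mem_Collect_eq fst_conv snd_conv)
  qed
qed

lemma frontier_region:
  assumes "m \<in> lines" "(t, L m t) \<in> closure (region S)"
  shows "(t, L m t) \<in> frontier (region S)"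
proof -
  have "(t, L m t) \<notin> region S"
    using region_above[of "(t, L m t)" S m] region_below[of "(t, L m t)" S m] assms(1) by auto
  then show ?thesis using assms(2) by (simp add: frontier_def interior_open[OF open_region])
qed

lemma insert_imp_passes_between_adjacent:
  assumes S: "insert m S \<subseteq> lines" "m \<notin> S" and ne: "region S \<noteq> {}" "region (insert m S) \<noteq> {}"
  shows "passes_between L m (region S) (region (insert m S))"
    and "adjacent n L (region S) (region (insert m S))"
proof -
  have m: "m \<in> lines" and S': "S \<subseteq> lines" using S by auto
  obtain a b where ab: "a < b"
    and near: "\<And>t. t \<in> {a..b} \<Longrightarrow> \<forall>\<^sub>F y in at_right (L m t). (t, y) \<in> region S"
      "\<And>t. t \<in> {a..b} \<Longrightarrow> \<forall>\<^sub>F y in at_left (L m t). (t, y) \<in> region (insert m S)"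
    using ex_interval_between[OF assms] by blast
  show "passes_between L m (region S) (region (insert m S))"
    unfolding passes_between_def using ab near by (intro exI[of _ a] exI[of _ b]) simp
  have "(t, L m t) \<in> frontier (region S) \<inter> frontier (region (insert m S))" if "t \<in> {a..b}" for t
    using frontier_region[OF m closure_from_above[OF near(1)[OF that]]]
      frontier_region[OF m closure_from_below[OF near(2)[OF that]]] by simp
  then have "(\<lambda>t. (t, L m t)) ` {a..b} \<subseteq> frontier (region S) \<inter> frontier (region (insert m S))"
    by blast
  moreover have "region S \<noteq> region (insert m S)"
    using label_region[OF S' ne(1)] label_region[OF S(1) ne(2)] S(2) by (metis insertI1)
  ultimately show "adjacent n L (region S) (region (insert m S))"
    unfolding adjacent_def using m ab by blast
qed

lemma card_top: "card (w k ` {1..l}) = l"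
  by (subst card_image) (auto simp: inj_on_def w_eq_iff)

lemma label_zone_from:
  assumes "k \<in> {1..N}"
  shows "label n L (zone_from n L (x k)) = w k ` {1..i k}"
  using zone_from_crossing[OF assms] label_region by simp

lemma adjacent_zones:
  assumes j: "j \<in> {1..N}" and k: "k \<in> {1..N}" and level: "i k = i j + 1"
  defines "A \<equiv> zone_from n L (x j)" and "B \<equiv> zone_from n L (x k)"
  shows "m \<in> lines \<Longrightarrow> passes_between L m A B \<longleftrightarrow>
      m \<notin> label n L A \<and> label n L B = label n L A \<union> {m}"
    and "adjacent n L A B \<longleftrightarrow> (\<exists>m\<in>lines. m \<notin> label n L A \<and> label n L B = label n L A \<union> {m})"
proof -
  define S S' where "S = w j ` {1..i j}" and "S' = w k ` {1..i k}"
  have A: "A = region S" "S \<subseteq> lines" "region S \<noteq> {}" "label n L A = S"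
    using zone_from_crossing[OF j] label_zone_from[OF j] unfolding A_def S_def by blast+
  have B: "B = region S'" "S' \<subseteq> lines" "region S' \<noteq> {}" "label n L B = S'"
    using zone_from_crossing[OF k] label_zone_from[OF k] unfolding B_def S'_def by blast+
  \<comment> \<open>A label has as many elements as the level of its zone, so the two labels differ
    by one in size.\<close>
  have card: "card S' = Suc (card S)" using level by (simp add: S_def S'_def card_top del: One_nat_def)
  have insert: "passes_between L m A B \<and> adjacent n L A B"
    if "m \<notin> S" "S' = insert m S" for m
    using insert_imp_passes_between_adjacent[of m S] A B that by simp
  show "passes_between L m A B \<longleftrightarrow> m \<notin> label n L A \<and> label n L B = label n L A \<union> {m}"
    if "m \<in> lines"
    using passes_between_label[OF A(2) B(2) that] insert[of m] unfolding A(4) B(4)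
    by (auto simp: A(1) B(1))
  show "adjacent n L A B \<longleftrightarrow> (\<exists>m\<in>lines. m \<notin> label n L A \<and> label n L B = label n L A \<union> {m})"
    using adjacent_label[OF A(2) B(2) card] insert unfolding A(4) B(4)
    by (auto simp: A(1) B(1))
qed

end

theorem lemma4p4:
  fixes n N :: nat and i w0 :: "nat \<Rightarrow> nat"
    and L :: "nat \<Rightarrow> real \<Rightarrow> real" and x :: "nat \<Rightarrow> real \<times> real"
    and Z :: "nat \<Rightarrow> (real \<times> real) set" and J :: "(real \<times> real) set \<Rightarrow> nat set"
  assumes "longest_element n w0"
    and "reduced_expression n N i w0"
    and "wiring_diagram n N i L x"
  defines "Z \<equiv> \<lambda>k. zone_from n L (x k)"
    and "J \<equiv> label n L"
  shows "(\<forall>k\<in>{1..N}. J (Z k) = word_prod i k ` {1..i k}) \<and>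
    (\<forall>j\<in>{1..N}. \<forall>k\<in>{1..N}. i k = i j + 1 \<longrightarrow>
       (adjacent n L (Z j) (Z k) \<longleftrightarrow> (\<exists>m\<in>{1..n + 1}. passes_between L m (Z j) (Z k))) \<and>
       (adjacent n L (Z j) (Z k) \<longleftrightarrow>
          (\<exists>m\<in>{1..n + 1}. m \<notin> J (Z j) \<and> J (Z k) = J (Z j) \<union> {m})) \<and>
       (\<forall>m\<in>{1..n + 1}. passes_between L m (Z j) (Z k) \<longleftrightarrow>
          m \<notin> J (Z j) \<and> J (Z k) = J (Z j) \<union> {m}))"
proof -
  interpret wiring n N i w0 L x
    using assms(2,3) by unfold_locales
  show ?thesis
    unfolding Z_def J_def
  proof (intro conjI ballI impI)
    fix k assume "k \<in> {1..N}"
    then show "label n L (zone_from n L (x k)) = word_prod i k ` {1..i k}" by (rule label_zone_from)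
  next
    fix j k assume jk: "j \<in> {1..N}" "k \<in> {1..N}" "i k = i j + 1"
    show "adjacent n L (zone_from n L (x j)) (zone_from n L (x k)) \<longleftrightarrow>
        (\<exists>m\<in>{1..n + 1}. passes_between L m (zone_from n L (x j)) (zone_from n L (x k)))"
      \<comment> \<open>Both sides reduce, line by line, to the condition on the labels.\<close>
      unfolding adjacent_zones(2)[OF jk] by (intro bex_cong[OF refl] adjacent_zones(1)[OF jk, symmetric])
  next
    fix j k assume jk: "j \<in> {1..N}" "k \<in> {1..N}" "i k = i j + 1"
    show "adjacent n L (zone_from n L (x j)) (zone_from n L (x k)) \<longleftrightarrow>
        (\<exists>m\<in>{1..n + 1}. m \<notin> label n L (zone_from n L (x j)) \<and>
          label n L (zone_from n L (x k)) = label n L (zone_from n L (x j)) \<union> {m})"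
      by (rule adjacent_zones(2)[OF jk])
  next
    fix j k m assume jk: "j \<in> {1..N}" "k \<in> {1..N}" "i k = i j + 1" and m: "m \<in> {1..n + 1}"
    show "passes_between L m (zone_from n L (x j)) (zone_from n L (x k)) \<longleftrightarrow>
        m \<notin> label n L (zone_from n L (x j)) \<and>
          label n L (zone_from n L (x k)) = label n L (zone_from n L (x j)) \<union> {m}"
      by (rule adjacent_zones(1)[OF jk m])
  qed
qed

end
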